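(* Let $n\ge 1$ be an integer, let $\alpha\in(0,2)$, and let $f,g\in C^1([0,+\infty)\times[0,+\infty),\mathbb{R})$. Let $u,v\in L_\alpha\cap C^{1,1}_{loc}(\mathbb{R}^n)$ be a positive solution of the system $$(-\Delta)^{\alpha/2}u(x)=f(u(x),v(x)),\quad (-\Delta)^{\alpha/2}v(x)=g(u(x),v(x)),\quad u(x)>0,\ v(x)>0,\qquad x\in\mathbb{R}^n.$$ Assume that $$\lim_{|x|\to\infty}u(x)=0,\qquad \lim_{|x|\to\infty}v(x)=0,$$ and that $\frac{\partial f}{\partial v}(u,v)>0$ and $\frac{\partial g}{\partial u}(u,v)>0$ for all $(u,v)\in(0,\infty)\times(0,\infty)$. Then there exists $l_0>0$ such that for all $0<l\le l_0$ and all $\lambda\in\mathbb{R}$, with $\Omega_{\lambda,l}:=\{x\in\Sigma_\lambda:\lambda-l<x_1<\lambda\}$: (c) if there is $x^*\in\Omega_{\lambda,l}$ satisfying $U_\lambda(x^* )=\min_{x\in\overline{\Sigma_\lambda}}U_\lambda(x)<0$, then $V_\lambda(x^* )<2U_\lambda(x^* )<0$; (d) if there is $y^*\in\Omega_{\lambda,l}$ satisfying $V_\lambda(y^* )=\min_{y\in\overline{\Sigma_\lambda}}V_\lambda(y)<0$, then $U_\lambda(y^* )<2V_\lambda(y^* )<0$.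
   Context: For $\alpha\in(0,2)$, the fractional Laplacian is $$(-\Delta)^{\alpha/2}u(x)=C_{n,\alpha}\lim_{\epsilon\to0}\int_{\mathbb{R}^n\setminus B_\epsilon(x)}\frac{u(x)-u(y)}{|x-y|^{n+\alpha}}\,dy,$$ where $C_{n,\alpha}>0$ is a normalization constant. $L_\alpha$ is the set of functions $u:\mathbb{R}^n\to\mathbb{R}$ with $\int_{\mathbb{R}^n}\frac{|u(x)|}{1+|x|^{n+\alpha}}dx<+\infty$. $C^{1,1}_{loc}(\mathbb{R}^n)$ is the set of $C^1$ functions with locally Lipschitz gradient. For $u\in L_\alpha\cap C^{1,1}_{loc}(\mathbb{R}^n)$ the limit as $\epsilon\to0$ defining $(-\Delta)^{\alpha/2}u(x)$ is well defined at every point, and equations are understood pointwise. Moving-plane notation: write $x=(x_1,x')$ with $x'\in\mathbb{R}^{n-1}$ (the $x_1$ direction may be any chosen direction). For $\lambda\in\mathbb{R}$ let $\Sigma_\lambda=\{x\in\mathbb{R}^n: x_1<\lambda\}$, let $x^\lambda=(2\lambda-x_1,x')$ be the reflection of $x$ in the hyperplane $\{x_1=\lambda\}$, and set $$U_\lambda(x)=u(x^\lambda)-u(x),\qquad V_\lambda(x)=v(x^\lambda)-v(x).$$ *)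

theory Defs
  imports "HOL-Analysis.Analysis"
begin

definition L_alpha :: "real \<Rightarrow> (real ^ 'n \<Rightarrow> real) set" where
  "L_alpha \<alpha> = {u \<in> borel_measurable lebesgue.
     integrable lebesgue (\<lambda>x. \<bar>u x\<bar> / (1 + norm x powr (real CARD('n) + \<alpha>)))}"

definition C11_loc :: "(real ^ 'n \<Rightarrow> real) set" where
  "C11_loc = {u. \<exists>G. (\<forall>x. GDERIV u x :> G x) \<and>
     (\<forall>x. \<exists>r>0. \<exists>L. L-lipschitz_on (ball x r) G)}"

(* "The fractional Laplacian of u at x exists and equals L".
   The normalization constant C is a parameter.
   The integral is over the exterior of a ball, where the kernel is bounded; for u in L_alpha it
   is absolutely convergent, so the default value of the Bochner integral does not interfere. *)
definition has_frac_laplacian ::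
    "real \<Rightarrow> real \<Rightarrow> (real ^ 'n \<Rightarrow> real) \<Rightarrow> real ^ 'n \<Rightarrow> real \<Rightarrow> bool" where
  "has_frac_laplacian C \<alpha> u x L \<longleftrightarrow>
     ((\<lambda>\<epsilon>. C * (LINT y:(UNIV - ball x \<epsilon>)|lebesgue.
            (u x - u y) / norm (x - y) powr (real CARD('n) + \<alpha>))) \<longlongrightarrow> L) (at_right 0)"

(* For a set with boundary such as the closed quadrant, derivatives at boundary points are taken
   within the set. *)
definition C1_on :: "'a::real_normed_vector set \<Rightarrow> ('a \<Rightarrow> real) \<Rightarrow> bool" where
  "C1_on S f \<longleftrightarrow> (\<exists>f' :: 'a \<Rightarrow> 'a \<Rightarrow>\<^sub>L real.
     (\<forall>p\<in>S. (f has_derivative blinfun_apply (f' p)) (at p within S)) \<and> continuous_on S f')"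

(* Moving planes in the direction of a unit vector e: the coordinate x_1 is the inner product
   of x and e. *)
definition half_space :: "real ^ 'n \<Rightarrow> real \<Rightarrow> (real ^ 'n) set" where
  "half_space e lam = {x. x \<bullet> e < lam}"

definition slab :: "real ^ 'n \<Rightarrow> real \<Rightarrow> real \<Rightarrow> (real ^ 'n) set" where
  "slab e lam l = {x \<in> half_space e lam. lam - l < x \<bullet> e \<and> x \<bullet> e < lam}"

(* Replaces the component x_1 by 2 * lam - x_1 and keeps the part orthogonal to e. *)
definition reflect :: "real ^ 'n \<Rightarrow> real \<Rightarrow> real ^ 'n \<Rightarrow> real ^ 'n" where
  "reflect e lam x = (x - (x \<bullet> e) *\<^sub>R e) + (2 * lam - x \<bullet> e) *\<^sub>R e"

definition refl_diff :: "real ^ 'n \<Rightarrow> real \<Rightarrow> (real ^ 'n \<Rightarrow> real) \<Rightarrow> real ^ 'n \<Rightarrow> real" where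
  "refl_diff e lam w x = w (reflect e lam x) - w x"

end

theory Submission
  imports Defs
begin

text \<open>
  Write \<open>U\<close>, \<open>V\<close> for the reflected differences of \<open>u\<close>, \<open>v\<close> and let \<open>x\<close> be a point at distance \<open>d < l\<close>
  from the hyperplane at which \<open>U\<close> attains a negative minimum over the closed half space. The proof
  compares two estimates of the fractional Laplacian of \<open>U\<close> at \<open>x\<close>.

  Nonlocality makes it very negative. Folding the integral over the hyperplane and using that \<open>U\<close> is
  antisymmetric, each pair of mirror points contributes at most \<open>2 U(x)\<close> times the kernel
  \<open>\<bar>x - y\<bar> powr - (n + \<alpha>)\<close> at the farther of the two. Keeping only the points \<open>y\<close> of one ball of radius
  \<open>d\<close>, at distance comparable to \<open>d\<close> on the other side of the hyperplane, leaves a negative quantity of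
  size at least \<open>c \<bar>U(x)\<bar> d powr - \<alpha>\<close>. This is \<open>frac_laplacian_antisymmetric_min\<close>.

  The equation keeps it from being too negative. The solutions are continuous and decay, so their values
  stay in some \<open>(0, M]\<close>, and on \<open>[0, M] \<times> [0, M]\<close> the nonlinearity is Lipschitz with a constant \<open>K\<close>. If
  \<open>V(x) \<ge> 2 U(x)\<close>, monotonicity of \<open>f\<close> in its second argument disposes of the case \<open>V(x) \<ge> 0\<close>, and in the
  other case \<open>\<bar>V(x)\<bar> \<le> 2 \<bar>U(x)\<bar>\<close>, so the increment of \<open>f\<close> is at least \<open>3 K U(x)\<close>
  (\<open>cooperative_increment_bound\<close>).

  Together these give \<open>c \<le> 3 K d powr \<alpha> \<le> 3 K l powr \<alpha>\<close>, which fails once \<open>l\<close> is small; the threshold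
  depends on \<open>K\<close>, \<open>C\<close>, \<open>n\<close> and \<open>\<alpha>\<close> alone, hence not on the hyperplane. The second claim is the first one
  with the two components exchanged.
\<close>

section \<open>Reflection in a hyperplane\<close>

lemma reflect_eq: "reflect e lam x = x + (2 * (lam - x \<bullet> e)) *\<^sub>R e"
  unfolding reflect_def by (simp add: algebra_simps flip: scaleR_add_left)

lemma inner_reflect:
  assumes "norm e = 1"
  shows "reflect e lam x \<bullet> e = 2 * lam - x \<bullet> e"
  using assms by (simp add: reflect_eq inner_add_left norm_eq_1)

lemma reflect_reflect:
  assumes "norm e = 1"
  shows "reflect e lam (reflect e lam x) = x"
proof -
  have "reflect e lam (reflect e lam x) = reflect e lam x + (2 * (lam - (2 * lam - x \<bullet> e))) *\<^sub>R e"
    using reflect_eq[of e lam "reflect e lam x"] by (simp only: inner_reflect[OF assms])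
  also have "\<dots> = x + (2 * (lam - x \<bullet> e)) *\<^sub>R e + (2 * (lam - (2 * lam - x \<bullet> e))) *\<^sub>R e"
    by (simp only: reflect_eq)
  also have "\<dots> = x + (2 * (lam - x \<bullet> e) + 2 * (lam - (2 * lam - x \<bullet> e))) *\<^sub>R e"
    by (simp only: scaleR_add_left add.assoc)
  finally show ?thesis by simp
qed

lemma refl_diff_reflect:
  assumes "norm e = 1"
  shows "refl_diff e lam w (reflect e lam x) = - refl_diff e lam w x"
  by (simp add: refl_diff_def reflect_reflect[OF assms])

text \<open>
  The correction term is positive exactly when both points lie strictly on the same side of the
  hyperplane, so reflecting one of two such points moves it away from the other.
\<close>
lemma norm_sq_diff_reflect:
  assumes "norm e = 1"
  shows "(norm (x - reflect e lam y))\<^sup>2 = (norm (x - y))\<^sup>2 + 4 * (lam - x \<bullet> e) * (lam - y \<bullet> e)"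
proof -
  have "e \<bullet> e = 1" using assms by (simp add: norm_eq_1)
  then show ?thesis
    unfolding power2_norm_eq_inner reflect_eq
    by (simp add: inner_add_left inner_add_right inner_diff_left inner_diff_right inner_commute algebra_simps)
qed

lemma norm_reflect_diff:
  assumes "norm e = 1"
  shows "norm (reflect e lam x - y) = norm (x - reflect e lam y)"
proof -
  have "4 * (lam - x \<bullet> e) * (lam - y \<bullet> e) = 4 * (lam - y \<bullet> e) * (lam - x \<bullet> e)"
    by (simp only: mult_ac)
  then have "(norm (y - reflect e lam x))\<^sup>2 = (norm (x - reflect e lam y))\<^sup>2"
    by (simp only: norm_sq_diff_reflect[OF assms] norm_minus_commute[of x y])
  then show ?thesis by (simp add: norm_minus_commute)
qed

lemma continuous_reflect: "continuous_on S (reflect e lam)"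
  unfolding reflect_eq[abs_def] by (intro continuous_intros)

lemma borel_measurable_reflect [measurable]: "reflect e lam \<in> borel_measurable borel"
  by (intro borel_measurable_continuous_onI continuous_reflect)

lemma nn_integral_lborel_translate:
  fixes t :: "'a::euclidean_space"
  assumes [measurable]: "h \<in> borel_measurable borel"
  shows "(\<integral>\<^sup>+ x. h (t + x) \<partial>lborel) = (\<integral>\<^sup>+ x. h x \<partial>lborel)"
  by (subst (2) lborel_distr_plus[of t, symmetric]) (simp add: nn_integral_distr)

lemma nn_integral_lborel_flip:
  fixes t :: "'a::euclidean_space"
  assumes [measurable]: "h \<in> borel_measurable borel"
  shows "(\<integral>\<^sup>+ x. h (t - x) \<partial>lborel) = (\<integral>\<^sup>+ x. h x \<partial>lborel)"
proof -
  have "distr lborel borel (\<lambda>x. t - x) = lborel"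
    using lborel_affine[of "-1" t] by (simp add: density_1)
  then show ?thesis
    using nn_integral_distr[of "\<lambda>x. t - x" lborel borel h] by simp
qed

text \<open>
  The image measure of Lebesgue measure is translation invariant, hence a multiple of Lebesgue measure,
  and the factor is one because the unit ball is carried to a ball of the same radius. Uniqueness of the
  invariant measure is the usual Fubini computation: the double integral of
  \<open>indicator A (R x) * indicator B (R x + y)\<close> is evaluated in both orders, where \<open>B\<close> is the unit ball and
  the inner integral is shifted so that \<open>y\<close> moves from \<open>B\<close> to \<open>A\<close>.
\<close>
lemma lborel_distr_reflect:
  fixes e :: "real ^ 'n"
  assumes e: "norm e = 1"
  shows "distr lborel borel (reflect e lam) = lborel"
proof (rule measure_eqI)
  fix A :: "(real ^ 'n) set"
  assume "A \<in> sets (distr lborel borel (reflect e lam))"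
  then have A [measurable]: "A \<in> sets borel" by simp
  let ?R = "reflect e lam" and ?Q = "reflect e 0"
  define B where "B = (ball 0 1 :: (real ^ 'n) set)"
  have B [measurable]: "B \<in> sets borel" by (simp add: B_def)
  \<comment> \<open>\<open>?Q\<close> is the linear part of \<open>?R\<close> and its own inverse,
    so shifting by \<open>- ?Q y\<close> before reflecting is shifting by \<open>- y\<close> after it.\<close>
  have shift: "?R (- ?Q y + x) = ?R x - y" for x y
  proof -
    have "?Q y \<bullet> e = - (y \<bullet> e)" by (simp add: inner_reflect[OF e])
    then have "?R (- ?Q y + x) = - ?Q y + x + (2 * (lam - (y \<bullet> e + x \<bullet> e))) *\<^sub>R e"
      by (simp only: reflect_eq[of e lam] inner_add_left inner_minus_left minus_minus)
    also have "\<dots> = x - y + (2 * (y \<bullet> e) + 2 * (lam - (y \<bullet> e + x \<bullet> e))) *\<^sub>R e"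
      by (simp only: reflect_eq[of e 0] scaleR_add_left) simp
    also have "\<dots> = ?R x - y"
      by (simp add: reflect_eq)
    finally show ?thesis .
  qed
  have "?R -` B = ball (?R 0) 1"
    unfolding B_def using norm_reflect_diff[OF e, of lam 0] norm_reflect_diff[OF e, of lam _ 0]
    by (auto simp: dist_norm norm_minus_commute)
  then have ind: "(indicator B (?R x) :: ennreal) = indicator (ball (?R 0) 1) x" for x
    by (metis indicator_vimage)
  have RB: "(\<integral>\<^sup>+ x. indicator B (?R x) \<partial>lborel) = emeasure lborel B"
    unfolding ind by (simp add: B_def emeasure_ball)
  have "(\<integral>\<^sup>+ x. indicator A (?R x) \<partial>lborel) * emeasure lborel B
      = (\<integral>\<^sup>+ x. indicator A (?R x) * emeasure lborel B \<partial>lborel)"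
    by (simp add: nn_integral_multc)
  also have "\<dots> = (\<integral>\<^sup>+ x. \<integral>\<^sup>+ y. indicator A (?R x) * indicator B (?R x + y) \<partial>lborel \<partial>lborel)"
  proof (rule nn_integral_cong)
    fix x
    show "indicator A (?R x) * emeasure lborel B
        = (\<integral>\<^sup>+ y. indicator A (?R x) * indicator B (?R x + y) \<partial>lborel)"
      using nn_integral_lborel_translate[where h = "indicator B" and t = "?R x"]
      by (subst nn_integral_cmult) simp_all
  qed
  also have "\<dots> = (\<integral>\<^sup>+ y. \<integral>\<^sup>+ x. indicator A (?R x) * indicator B (?R x + y) \<partial>lborel \<partial>lborel)"
    by (rule lborel_pair.Fubini'[symmetric]) measurable
  also have "\<dots> = (\<integral>\<^sup>+ y. \<integral>\<^sup>+ x. indicator A (?R x - y) * indicator B (?R x) \<partial>lborel \<partial>lborel)"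
  proof (rule nn_integral_cong)
    fix y
    show "(\<integral>\<^sup>+ x. indicator A (?R x) * indicator B (?R x + y) \<partial>lborel) =
        (\<integral>\<^sup>+ x. indicator A (?R x - y) * indicator B (?R x) \<partial>lborel)"
      using nn_integral_lborel_translate[where t = "- ?Q y"
          and h = "\<lambda>x. indicator A (?R x) * indicator B (?R x + y)"]
      by (simp add: shift[unfolded uminus_add_conv_diff])
  qed
  also have "\<dots> = (\<integral>\<^sup>+ x. \<integral>\<^sup>+ y. indicator A (?R x - y) * indicator B (?R x) \<partial>lborel \<partial>lborel)"
    by (rule lborel_pair.Fubini') measurable
  also have "\<dots> = (\<integral>\<^sup>+ x. emeasure lborel A * indicator B (?R x) \<partial>lborel)"
  proof (rule nn_integral_cong)
    fix x
    show "(\<integral>\<^sup>+ y. indicator A (?R x - y) * indicator B (?R x) \<partial>lborel)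
        = emeasure lborel A * indicator B (?R x)"
      using nn_integral_lborel_flip[where h = "indicator A" and t = "?R x"]
      by (subst nn_integral_multc) simp_all
  qed
  also have "\<dots> = emeasure lborel A * emeasure lborel B"
    by (simp add: nn_integral_cmult RB)
  finally have *: "(\<integral>\<^sup>+ x. indicator A (?R x) \<partial>lborel) * emeasure lborel B
      = emeasure lborel A * emeasure lborel B" .
  have B': "emeasure lborel B = ennreal (unit_ball_vol (real CARD('n)))"
    by (simp add: B_def emeasure_ball)
  have "emeasure lborel B \<noteq> 0" "emeasure lborel B \<noteq> top"
    unfolding B' by (simp_all add: ennreal_eq_0_iff not_le)
  then have "(\<integral>\<^sup>+ x. indicator A (?R x) \<partial>lborel) = emeasure lborel A"
    using * by (simp add: ennreal_mult_cancel_left mult.commute[of _ "emeasure lborel B"])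
  moreover have "emeasure (distr lborel borel ?R) A = (\<integral>\<^sup>+ x. indicator A x \<partial>distr lborel borel ?R)"
    by (rule nn_integral_indicator[symmetric]) simp
  moreover have "\<dots> = (\<integral>\<^sup>+ x. indicator A (?R x) \<partial>lborel)"
    by (rule nn_integral_distr) measurable
  ultimately show "emeasure (distr lborel borel ?R) A = emeasure lborel A"
    by simp
qed simp

section \<open>The truncated kernel\<close>

definition trunc_kernel :: "real \<Rightarrow> real \<Rightarrow> 'a::euclidean_space \<Rightarrow> real" where
  "trunc_kernel p r z = (if r \<le> norm z then 1 / norm z powr p else 0)"

lemma trunc_kernel_nonneg: "0 \<le> trunc_kernel p r z"
  by (simp add: trunc_kernel_def)

lemma trunc_kernel_measurable [measurable]: "trunc_kernel p r \<in> borel_measurable borel"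
  unfolding trunc_kernel_def[abs_def] by measurable

text \<open>
  On the dyadic shell \<open>2 ^ k * r \<le> norm z < 2 ^ Suc k * r\<close> the kernel is at most \<open>(2 ^ k * r) powr - p\<close>,
  while the shell has volume of order \<open>(2 ^ k * r) ^ n\<close>, so for \<open>p > n\<close> the shells are dominated by a
  geometric series. Each shell is enlarged to a full ball, which only changes the constant.
\<close>
lemma integrable_trunc_kernel:
  fixes x :: "'a::euclidean_space"
  assumes p: "real DIM('a) < p" and r: "0 < r"
  shows "integrable lborel (\<lambda>y. trunc_kernel p r (x - y))"
proof -
  let ?n = "DIM('a)"
  define F where "F = (\<lambda>k y::'a. indicator (ball x (2 ^ Suc k * r)) y / (2 ^ k * r) powr p)"
  define q where "q = 2 powr (real ?n - p)"
  have q: "0 \<le> q" "q < 1"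
    using p by (simp_all add: q_def powr_less_one)
  have p0: "0 < p" using p by (meson less_trans of_nat_0_le_iff le_less_trans)
  have pow: "(2 ^ k * r) powr p = (2 powr p) ^ k * r powr p" for k :: nat
    using r by (simp add: powr_mult powr_powr flip: powr_realpow) (simp add: mult.commute)
  have Fint: "integrable lborel (F k)" for k
    unfolding F_def by (intro integrable_divide integrable_real_indicator)
      (auto simp: emeasure_ball r less_imp_le)
  have "integral\<^sup>L lborel (F k) = unit_ball_vol ?n * (2 * r) ^ ?n / r powr p * q ^ k" for k
  proof -
    have "integral\<^sup>L lborel (F k) = unit_ball_vol ?n * (2 ^ Suc k * r) ^ ?n / (2 ^ k * r) powr p"
      unfolding F_def using r by (simp add: content_ball)
    also have "\<dots> = unit_ball_vol ?n * (2 * r) ^ ?n / r powr p * ((2 ^ ?n) ^ k / (2 powr p) ^ k)"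
      by (simp add: pow[unfolded mult.commute[of _ r]] power_mult_distrib mult_ac flip: power_mult)
    also have "(2 ^ ?n) ^ k / (2 powr p) ^ k = q ^ k"
      by (simp add: q_def powr_diff powr_realpow power_divide)
    finally show ?thesis .
  qed
  then have sum_int: "summable (\<lambda>k. \<integral>y. norm (F k y) \<partial>lborel)"
    using q by (simp add: F_def summable_mult summable_geometric)
  have "summable (\<lambda>k. 1 / r powr p * (1 / 2 powr p) ^ k)"
    using p0 by (intro summable_mult summable_geometric) simp
  then have sum_pt: "summable (\<lambda>k. norm (F k y))" for y
    by (rule summable_comparison_test_ev[rotated])
      (auto simp: F_def pow pow[unfolded mult.commute[of _ r]] power_one_over field_simps indicator_def)
  have S: "integrable lborel (\<lambda>y. \<Sum>k. F k y)"
    by (rule integrable_suminf[OF Fint]) (use sum_pt sum_int in auto)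
  have le: "trunc_kernel p r (x - y) \<le> (\<Sum>k. F k y)" for y
  proof (cases "r \<le> norm (x - y)")
    case False
    then show ?thesis
      by (auto simp: trunc_kernel_def F_def intro!: suminf_nonneg sum_pt[unfolded F_def, simplified])
  next
    case True
    \<comment> \<open>The index is the least one whose ball contains \<open>y\<close>,
      so \<open>y\<close> is outside the next smaller ball and its kernel value is at most the \<open>k\<close>-th term.\<close>
    obtain m :: nat where m: "norm (x - y) / r < 2 ^ m"
      using real_arch_pow[of 2 "norm (x - y) / r"] by auto
    define k where "k = (LEAST m::nat. norm (x - y) / r < 2 ^ Suc m)"
    have k1: "norm (x - y) / r < 2 ^ Suc k"
    proof -
      have "norm (x - y) / r < 2 ^ Suc m"
        using m zero_le_power[of "2::real" m] unfolding power_Suc by linarith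
      then show ?thesis unfolding k_def by (rule LeastI)
    qed
    have k2: "2 ^ k \<le> norm (x - y) / r"
    proof (cases k)
      case 0
      then show ?thesis using True r by simp
    next
      case (Suc j)
      then show ?thesis using not_less_Least[of j "\<lambda>m. norm (x - y) / r < 2 ^ Suc m"]
        by (simp add: k_def)
    qed
    have kr: "2 ^ k * r \<le> norm (x - y)" using k2 r by (simp add: field_simps)
    have kr0: "0 < 2 ^ k * r" using r by simp
    have "trunc_kernel p r (x - y) = 1 / norm (x - y) powr p"
      using True by (simp add: trunc_kernel_def)
    also have "\<dots> \<le> 1 / (2 ^ k * r) powr p"
      using kr kr0 p0 by (intro frac_le powr_mono2) auto
    also have "\<dots> = F k y"
      using k1 r by (simp add: F_def dist_norm field_simps)
    also have "\<dots> \<le> (\<Sum>k. F k y)"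
      using sum_le_suminf[of "\<lambda>k. F k y" "{k}"] sum_pt[of y] by (simp add: F_def)
    finally show ?thesis .
  qed
  have "norm (trunc_kernel p r (x - y)) \<le> norm (\<Sum>k. F k y)" for y
    using le[of y] trunc_kernel_nonneg[of p r "x - y"] unfolding real_norm_def by linarith
  then show ?thesis
    by (intro Bochner_Integration.integrable_bound[OF S] AE_I2) simp_all
qed

text \<open>
  For Borel functions the completed measure can be dropped, which makes transformation and product
  formulas for \<^const>\<open>lborel\<close> applicable.
\<close>
lemma frac_integral_eq_trunc_kernel:
  fixes u :: "real ^ 'n \<Rightarrow> real"
  assumes [measurable]: "u \<in> borel_measurable borel"
  shows "(LINT y:(UNIV - ball x r)|lebesgue. (u x - u y) / norm (x - y) powr p)
    = (\<integral>y. (u x - u y) * trunc_kernel p r (x - y) \<partial>lborel)"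
proof -
  have "(LINT y:(UNIV - ball x r)|lebesgue. (u x - u y) / norm (x - y) powr p)
      = (\<integral>y. (u x - u y) * trunc_kernel p r (x - y) \<partial>lebesgue)"
    unfolding set_lebesgue_integral_def
    by (intro Bochner_Integration.integral_cong) (auto simp: trunc_kernel_def dist_norm)
  also have "\<dots> = (\<integral>y. (u x - u y) * trunc_kernel p r (x - y) \<partial>lborel)"
    by (rule integral_completion) measurable
  finally show ?thesis .
qed

lemma integrable_bounded_mult_trunc_kernel:
  fixes h :: "real ^ 'n \<Rightarrow> real"
  assumes [measurable]: "h \<in> borel_measurable borel" and M: "\<And>y. \<bar>h y\<bar> \<le> M"
    and p: "real CARD('n) < p" and r: "0 < r"
  shows "integrable lborel (\<lambda>y. h y * trunc_kernel p r (x - y))"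
proof -
  have "integrable lborel (\<lambda>y. M * trunc_kernel p r (x - y))"
    by (intro integrable_mult_right integrable_trunc_kernel) (use p r in auto)
  then show ?thesis
  proof (rule Bochner_Integration.integrable_bound)
    have "norm (h y * trunc_kernel p r (x - y)) \<le> norm (M * trunc_kernel p r (x - y))" for y
      using mult_right_mono[OF M[of y] trunc_kernel_nonneg[of p r "x - y"]]
        order_trans[OF abs_ge_zero M[of y]]
      by (simp add: abs_mult trunc_kernel_nonneg)
    then show "AE y in lborel. norm (h y * trunc_kernel p r (x - y)) \<le> norm (M * trunc_kernel p r (x - y))"
      by simp
  qed measurable
qed

section \<open>The fractional Laplacian at a negative minimum\<close>

lemma trunc_kernel_reflect:
  assumes "norm e = 1"
  shows "trunc_kernel p r (reflect e lam x - y) = trunc_kernel p r (x - reflect e lam y)"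
  by (simp add: trunc_kernel_def norm_reflect_diff[OF assms])

lemma integral_lborel_reflect:
  fixes h :: "real ^ 'n \<Rightarrow> real"
  assumes "norm e = 1" and [measurable]: "h \<in> borel_measurable borel"
  shows "(\<integral>y. h (reflect e lam y) \<partial>lborel) = (\<integral>y. h y \<partial>lborel)"
  using integral_distr[of "reflect e lam" lborel borel h] by (simp add: lborel_distr_reflect[OF assms(1)])

lemma integrable_lborel_reflect:
  fixes h :: "real ^ 'n \<Rightarrow> real"
  assumes "norm e = 1" and "integrable lborel h"
  shows "integrable lborel (\<lambda>y. h (reflect e lam y))"
  by (rule integrable_distr[of "reflect e lam" lborel borel])
    (use assms in \<open>simp_all add: lborel_distr_reflect\<close>)

text \<open>
  Reflecting the variable of integration turns the integral for \<open>w\<close> at the mirror point into one centred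
  at \<open>x\<close>, so the two integrals combine into one for \<open>W\<close>. Averaging that integral with its own reflection
  folds it over the hyperplane, which explains the factor two; integrating the sum over the whole space
  avoids splitting the domain along the hyperplane.
\<close>
lemma trunc_integral_refl_diff:
  fixes w :: "real ^ 'n \<Rightarrow> real" and lam :: real
  assumes e: "norm e = 1" and [measurable]: "w \<in> borel_measurable borel" and M: "\<And>y. \<bar>w y\<bar> \<le> M"
    and p: "real CARD('n) < p" and r: "0 < r"
  defines "W \<equiv> refl_diff e lam w" and "k \<equiv> trunc_kernel p r"
  shows "2 * ((\<integral>y. (w (reflect e lam x) - w y) * k (reflect e lam x - y) \<partial>lborel)
      - (\<integral>y. (w x - w y) * k (x - y) \<partial>lborel))
    = (\<integral>y. (W x - W y) * k (x - y) + (W x + W y) * k (x - reflect e lam y) \<partial>lborel)"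
    and "integrable lborel (\<lambda>y. (W x - W y) * k (x - y) + (W x + W y) * k (x - reflect e lam y))"
proof -
  let ?R = "reflect e lam"
  have [measurable]: "k \<in> borel_measurable borel" by (simp add: k_def)
  have [measurable]: "W \<in> borel_measurable borel" by (simp add: W_def refl_diff_def[abs_def])
  have bnd: "\<bar>a - w y\<bar> \<le> \<bar>a\<bar> + M" for a y using M[of y] by linarith
  have bR: "\<bar>a - w (?R y)\<bar> \<le> \<bar>a\<bar> + M" for a y using M[of "?R y"] by linarith
  have bW: "\<bar>W x - W y\<bar> \<le> 4 * M" for y
    using M[of x] M[of y] M[of "?R x"] M[of "?R y"] unfolding W_def refl_diff_def by linarith
  have i1: "integrable lborel (\<lambda>y. (w x - w y) * k (x - y))"
    unfolding k_def by (rule integrable_bounded_mult_trunc_kernel[OF _ bnd p r]) measurable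
  have i2: "integrable lborel (\<lambda>y. (w (?R x) - w (?R y)) * k (x - y))"
    unfolding k_def by (rule integrable_bounded_mult_trunc_kernel[OF _ bR p r]) measurable
  have i3: "integrable lborel (\<lambda>y. (W x - W y) * k (x - y))"
    unfolding k_def by (rule integrable_bounded_mult_trunc_kernel[OF _ bW p r]) measurable
  have anti: "W (?R y) = - W y" for y
    unfolding W_def by (rule refl_diff_reflect[OF e])
  have kR: "k (?R x - ?R y) = k (x - y)" for y
    unfolding k_def by (simp add: trunc_kernel_reflect[OF e] reflect_reflect[OF e])
  have "(\<integral>y. (w (?R x) - w y) * k (?R x - y) \<partial>lborel)
      = (\<integral>y. (w (?R x) - w (?R y)) * k (x - y) \<partial>lborel)"
    using integral_lborel_reflect[OF e, of "\<lambda>y. (w (?R x) - w y) * k (?R x - y)" lam]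
    by (simp add: kR)
  then have 1: "(\<integral>y. (w (?R x) - w y) * k (?R x - y) \<partial>lborel) - (\<integral>y. (w x - w y) * k (x - y) \<partial>lborel)
      = (\<integral>y. (W x - W y) * k (x - y) \<partial>lborel)"
    using Bochner_Integration.integral_diff[OF i2 i1]
    by (simp add: W_def refl_diff_def algebra_simps)
  have i4: "integrable lborel (\<lambda>y. (W x + W y) * k (x - ?R y))"
    using integrable_lborel_reflect[OF e i3, of lam] by (simp add: anti)
  have 2: "(\<integral>y. (W x + W y) * k (x - ?R y) \<partial>lborel) = (\<integral>y. (W x - W y) * k (x - y) \<partial>lborel)"
    using integral_lborel_reflect[OF e, of "\<lambda>y. (W x - W y) * k (x - y)" lam]
    by (simp add: anti)
  show "2 * ((\<integral>y. (w (?R x) - w y) * k (?R x - y) \<partial>lborel) - (\<integral>y. (w x - w y) * k (x - y) \<partial>lborel))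
    = (\<integral>y. (W x - W y) * k (x - y) + (W x + W y) * k (x - ?R y) \<partial>lborel)"
    unfolding 1 using Bochner_Integration.integral_add[OF i3 i4] 2 by simp
  show "integrable lborel (\<lambda>y. (W x - W y) * k (x - y) + (W x + W y) * k (x - ?R y))"
    using i3 i4 by (rule Bochner_Integration.integrable_add)
qed

lemma inner_diff_le_norm:
  assumes "norm e = 1"
  shows "\<bar>x \<bullet> e - y \<bullet> e\<bar> \<le> norm (x - y)"
  using Cauchy_Schwarz_ineq2[of "x - y" e] assms by (simp add: inner_diff_left)

text \<open>
  If \<open>y\<close> is on the side of \<open>x\<close>, then \<open>W x - W y \<le> 0\<close> meets the larger kernel value, so replacing that value
  by the one at the mirror point only increases the sum, and the terms with \<open>W y\<close> cancel. This fails for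
  \<open>y\<close> within distance \<open>r\<close> of \<open>x\<close>, where the truncated kernel vanishes; there the left side is nonpositive
  because \<open>W\<close> is negative near \<open>x\<close>. The centre of \<open>B\<close> is \<open>3 * d\<close> behind the hyperplane, so that the mirror
  image of \<open>B\<close> stays at distance at least \<open>d\<close> from \<open>x\<close> and the right side vanishes for such \<open>y\<close>.
\<close>
lemma antisymmetric_min_kernel_bound:
  fixes W :: "real ^ 'n \<Rightarrow> real"
  assumes e: "norm e = 1" and anti: "\<And>y. W (reflect e lam y) = - W y"
    and d: "d = lam - x \<bullet> e" and r: "0 < r" "r < d" and p: "0 \<le> p"
    and min: "\<And>y. y \<bullet> e \<le> lam \<Longrightarrow> W x \<le> W y"
    and neg: "\<And>y. norm (x - y) < r \<Longrightarrow> W y < 0"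
  defines "k \<equiv> trunc_kernel p r" and "B \<equiv> ball (x + (4 * d) *\<^sub>R e) d"
  shows "(W x - W y) * k (x - y) + (W x + W y) * k (x - reflect e lam y)
    \<le> 2 * W x / (5 * d) powr p * (indicator B y + indicator B (reflect e lam y))"
proof -
  let ?R = "reflect e lam"
  define c where "c = 1 / (5 * d) powr p"
  have ee: "e \<bullet> e = 1" using e by (simp add: norm_eq_1)
  have Wx: "W x < 0" using neg[of x] r by simp
  have inB: "z \<bullet> e > x \<bullet> e + 3 * d" "norm (x - z) < 5 * d" if "z \<in> B" for z
  proof -
    have z: "norm (x + (4 * d) *\<^sub>R e - z) < d" using that by (simp add: B_def dist_norm)
    then show "z \<bullet> e > x \<bullet> e + 3 * d"
      using inner_diff_le_norm[OF e, of "x + (4 * d) *\<^sub>R e" z] ee by (simp add: inner_add_left)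
    have "norm (x - z) \<le> norm (x + (4 * d) *\<^sub>R e - z) + norm ((4 * d) *\<^sub>R e)"
      using norm_triangle_ineq4[of "x + (4 * d) *\<^sub>R e - z" "(4 * d) *\<^sub>R e"] by simp
    then show "norm (x - z) < 5 * d" using z e r by simp
  qed
  \<comment> \<open>Both sides are unchanged when \<open>y\<close> is replaced by its mirror image, so one side of the hyperplane suffices.\<close>
  have main: "(W x - W y) * k (x - y) + (W x + W y) * k (x - ?R y)
    \<le> 2 * W x * c * (indicator B y + indicator B (?R y))" if y: "y \<bullet> e \<le> lam" for y
  proof -
    have yB: "y \<notin> B" using inB(1)[of y] y d r by auto
    have Ry: "?R y \<bullet> e = 2 * lam - y \<bullet> e" by (rule inner_reflect[OF e])
    have far: "d \<le> norm (x - ?R y)"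
      using inner_diff_le_norm[OF e, of x "?R y"] y d Ry by linarith
    have k2: "k (x - ?R y) = 1 / norm (x - ?R y) powr p"
      using far r by (simp add: k_def trunc_kernel_def)
    have k20: "0 \<le> k (x - ?R y)" by (simp add: k_def trunc_kernel_nonneg)
    show ?thesis
    proof (cases "norm (x - y) < r")
      case True
      have "?R y \<notin> B"
        using inB(1)[of "?R y"] inner_diff_le_norm[OF e, of x y] True r d Ry by auto
      moreover have "k (x - y) = 0" using True by (simp add: k_def trunc_kernel_def)
      moreover have "(W x + W y) * k (x - ?R y) \<le> 0"
        using neg[OF True] Wx k20 by (intro mult_nonpos_nonneg) auto
      ultimately show ?thesis using yB by simp
    next
      case False
      have "(norm (x - y))\<^sup>2 \<le> (norm (x - ?R y))\<^sup>2"
        using y d r unfolding norm_sq_diff_reflect[OF e] by simp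
      then have "norm (x - y) \<le> norm (x - ?R y)" by (rule power2_le_imp_le) simp
      then have "k (x - ?R y) \<le> k (x - y)"
        using False r p unfolding k2 by (auto simp: k_def trunc_kernel_def intro!: frac_le powr_mono2)
      then have "(W x - W y) * k (x - y) \<le> (W x - W y) * k (x - ?R y)"
        using min[OF y] by (intro mult_left_mono_neg) auto
      then have "(W x - W y) * k (x - y) + (W x + W y) * k (x - ?R y) \<le> 2 * W x * k (x - ?R y)"
        by (simp add: algebra_simps)
      also have "c * indicator B (?R y) \<le> k (x - ?R y)"
      proof (cases "?R y \<in> B")
        case True
        then have "norm (x - ?R y) \<le> 5 * d" using inB(2) by (simp add: less_imp_le)
        then have "c \<le> k (x - ?R y)"
          unfolding k2 c_def using far r p by (intro frac_le powr_mono2) auto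
        then show ?thesis using True by simp
      qed (use k20 in simp)
      then have "2 * W x * k (x - ?R y) \<le> 2 * W x * (c * indicator B (?R y))"
        using Wx by (intro mult_left_mono_neg) auto
      finally show ?thesis using yB by simp
    qed
  qed
  have "(W x - W y) * k (x - y) + (W x + W y) * k (x - ?R y)
    \<le> 2 * W x * c * (indicator B y + indicator B (?R y))"
  proof (cases "y \<bullet> e \<le> lam")
    case False
    then have "?R y \<bullet> e \<le> lam" by (simp add: inner_reflect[OF e])
    from main[OF this] show ?thesis by (simp add: anti reflect_reflect[OF e] add.commute)
  qed (rule main)
  then show ?thesis by (simp add: c_def)
qed

text \<open>
  The pointwise bound holds for all small truncation radii with a right side independent of the radius,
  so it integrates and passes to the limit. The ball of radius \<open>d\<close> contributes \<open>d ^ n\<close> and the kernel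
  \<open>(5 * d) powr - (n + \<alpha>)\<close>, which leaves the singular factor \<open>d powr - \<alpha>\<close>.
\<close>
proposition frac_laplacian_antisymmetric_min:
  fixes w :: "real ^ 'n \<Rightarrow> real"
  assumes \<alpha>: "0 < \<alpha>" and C: "0 < C" and e: "norm e = 1"
    and cont: "continuous_on UNIV w" and M: "\<And>y. \<bar>w y\<bar> \<le> M"
    and lap: "has_frac_laplacian C \<alpha> w x F" "has_frac_laplacian C \<alpha> w (reflect e lam x) F'"
    and x: "x \<bullet> e < lam"
    and min: "\<And>y. y \<bullet> e \<le> lam \<Longrightarrow> refl_diff e lam w x \<le> refl_diff e lam w y"
    and neg: "refl_diff e lam w x < 0"
  shows "F' - F \<le> 2 * C * unit_ball_vol (real CARD('n)) / 5 powr (real CARD('n) + \<alpha>)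
    * refl_diff e lam w x / (lam - x \<bullet> e) powr \<alpha>"
proof -
  let ?R = "reflect e lam"
  define W where "W = refl_diff e lam w"
  define d where "d = lam - x \<bullet> e"
  define p where "p = real CARD('n) + \<alpha>"
  define B where "B = ball (x + (4 * d) *\<^sub>R e) d"
  have d0: "0 < d" using x by (simp add: d_def)
  have w [measurable]: "w \<in> borel_measurable borel"
    using cont by (rule borel_measurable_continuous_onI)
  have anti: "W (?R y) = - W y" for y
    unfolding W_def by (rule refl_diff_reflect[OF e])
  have "continuous_on UNIV W"
    unfolding W_def refl_diff_def[abs_def]
    by (intro continuous_on_diff cont continuous_on_compose2[OF cont] continuous_reflect) auto
  then have "eventually (\<lambda>y. W y < 0) (at x)"
    using neg by (intro order_tendstoD[of W "W x"]) (auto simp: W_def continuous_on_def)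
  then obtain \<delta> where \<delta>: "0 < \<delta>" "\<And>y. norm (x - y) < \<delta> \<Longrightarrow> W y < 0"
    using neg unfolding eventually_at W_def by (metis UNIV_I dist_norm norm_minus_commute)
  let ?I = "\<lambda>z r. C * (LINT y:(UNIV - ball z r)|lebesgue. (w z - w y) / norm (z - y) powr p)"
  have lim: "((\<lambda>r. ?I (?R x) r - ?I x r) \<longlongrightarrow> F' - F) (at_right 0)"
    using lap unfolding has_frac_laplacian_def p_def by (intro tendsto_diff) auto
  have vol: "measure lborel B = unit_ball_vol (real CARD('n)) * d ^ CARD('n)"
    unfolding B_def using d0 by (simp add: content_ball)
  have [measurable]: "B \<in> sets borel" by (simp add: B_def)
  have iB: "integrable lborel (indicator B :: real ^ 'n \<Rightarrow> real)"
    unfolding B_def by (intro integrable_real_indicator) (auto simp: emeasure_ball d0 less_imp_le)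
  have le: "?I (?R x) r - ?I x r \<le> C * (2 * W x / (5 * d) powr p * measure lborel B)"
    if r: "0 < r" "r < min d \<delta>" for r
  proof -
    let ?k = "trunc_kernel p r"
    let ?L = "\<lambda>y. (W x - W y) * ?k (x - y) + (W x + W y) * ?k (x - ?R y)"
    let ?H = "\<lambda>y. 2 * W x / (5 * d) powr p * (indicator B y + indicator B (?R y))"
    have p: "real CARD('n) < p" using \<alpha> by (simp add: p_def)
    note L = trunc_integral_refl_diff[OF e w M p r(1), of lam x, folded W_def]
    have iBR: "integrable lborel (\<lambda>y. indicator B (?R y) :: real)"
      by (rule integrable_lborel_reflect[OF e iB])
    have iH: "integrable lborel ?H"
      using iB iBR by (intro integrable_mult_right Bochner_Integration.integrable_add)
    have "(\<integral>y. indicator B (?R y) \<partial>lborel) = measure lborel B"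
      using integral_lborel_reflect[OF e, of "indicator B" lam] by simp
    then have H: "(\<integral>y. ?H y \<partial>lborel) = 2 * (2 * W x / (5 * d) powr p * measure lborel B)"
      using Bochner_Integration.integral_add[OF iB iBR] by simp
    have LH: "integral\<^sup>L lborel ?L \<le> integral\<^sup>L lborel ?H"
    proof (rule integral_mono[OF L(2) iH])
      show "?L y \<le> ?H y" for y
        unfolding B_def
        by (rule antisymmetric_min_kernel_bound[where W = W, OF e anti d_def])
          (use r \<delta> p min in \<open>auto simp: W_def\<close>)
    qed
    have "(\<integral>y. (w (?R x) - w y) * ?k (?R x - y) \<partial>lborel) - (\<integral>y. (w x - w y) * ?k (x - y) \<partial>lborel)
        \<le> 2 * W x / (5 * d) powr p * measure lborel B"
      using LH unfolding L(1)[symmetric] H by (rule mult_left_le_imp_le) simp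
    then show ?thesis
      unfolding frac_integral_eq_trunc_kernel[OF w] right_diff_distrib[symmetric]
      using C by (intro mult_left_mono) auto
  qed
  have "F' - F \<le> C * (2 * W x / (5 * d) powr p * measure lborel B)"
  proof (rule tendsto_upperbound[OF lim])
    show "\<forall>\<^sub>F r in at_right 0. ?I (?R x) r - ?I x r \<le> C * (2 * W x / (5 * d) powr p * measure lborel B)"
      unfolding eventually_at_right_field using le d0 \<delta>(1) by (intro exI[of _ "min d \<delta>"]) auto
  qed simp
  also have "\<dots> = 2 * C * unit_ball_vol (real CARD('n)) * W x * (d ^ CARD('n) / (5 * d) powr p)"
    unfolding vol by simp
  also have "d ^ CARD('n) / (5 * d) powr p = 1 / 5 powr p / d powr \<alpha>"
    using d0 by (simp add: p_def powr_mult powr_add powr_realpow)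
  also have "2 * C * unit_ball_vol (real CARD('n)) * W x * (1 / 5 powr p / d powr \<alpha>)
      = 2 * C * unit_ball_vol (real CARD('n)) / 5 powr p * W x / d powr \<alpha>"
    by simp
  finally show ?thesis by (simp add: W_def d_def p_def)
qed

section \<open>Cooperative nonlinearities\<close>

lemma C1_on_quadrant_differentiable:
  fixes f :: "real \<times> real \<Rightarrow> real"
  assumes f: "C1_on ({0..} \<times> {0..}) f" and "0 < a" "0 < b"
  shows "f differentiable (at (a, b))"
proof -
  obtain f' where f': "\<And>q. q \<in> {0..} \<times> {0..} \<Longrightarrow>
      (f has_derivative blinfun_apply (f' q)) (at q within {0..} \<times> {0..})"
    using f unfolding C1_on_def by blast
  have "{0<..} \<times> {0<..} \<subseteq> interior ({0..} \<times> {0..} :: (real \<times> real) set)"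
    by (rule interior_maximal) (auto intro!: open_Times)
  then have "(a, b) \<in> interior ({0..} \<times> {0..})"
    using assms by auto
  then have "at (a, b) within {0..} \<times> {0..} = at (a, b)"
    by (rule at_within_interior)
  then show ?thesis
    using f'[of "(a, b)"] assms by (auto simp: differentiable_def)
qed

text \<open>
  The box touches the boundary of the quadrant because the solutions have infimum zero; there
  the bound comes from the continuity of the one-sided derivative up to the boundary.
\<close>
lemma C1_on_quadrant_Lipschitz_box:
  fixes f :: "real \<times> real \<Rightarrow> real"
  assumes f: "C1_on ({0..} \<times> {0..}) f"
  obtains K where "0 < K" "\<And>p q. p \<in> {0..M} \<times> {0..M} \<Longrightarrow> q \<in> {0..M} \<times> {0..M} \<Longrightarrow>
    \<bar>f p - f q\<bar> \<le> K * norm (p - q)"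
proof -
  let ?S = "{0..M} \<times> {0..M}"
  have sub: "?S \<subseteq> {0..} \<times> {0..}" by auto
  obtain f' where f': "\<And>q. q \<in> {0..} \<times> {0..} \<Longrightarrow>
      (f has_derivative blinfun_apply (f' q)) (at q within {0..} \<times> {0..})"
    and cont: "continuous_on ({0..} \<times> {0..}) f'"
    using f unfolding C1_on_def by blast
  have "compact (f' ` ?S)"
    by (intro compact_continuous_image continuous_on_subset[OF cont sub] compact_Times) auto
  then obtain K where K: "0 < K" "\<And>q. q \<in> ?S \<Longrightarrow> norm (f' q) \<le> K"
    using compact_imp_bounded bounded_pos by (metis image_eqI)
  have "norm (f p - f q) \<le> K * norm (p - q)" if "p \<in> ?S" "q \<in> ?S" for p q
  proof (rule differentiable_bound)
    show "convex ?S" by (intro convex_Times) auto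
    show "(f has_derivative blinfun_apply (f' z)) (at z within ?S)" if "z \<in> ?S" for z
      using f' that sub by (meson has_derivative_subset subsetD)
    show "onorm (blinfun_apply (f' z)) \<le> K" if "z \<in> ?S" for z
      using K(2)[OF that] by (simp add: norm_blinfun.rep_eq)
  qed fact+
  then show ?thesis using K(1) that by simp
qed

lemma deriv_pos_imp_mono:
  fixes h :: "real \<Rightarrow> real"
  assumes "\<And>t. 0 < t \<Longrightarrow> h differentiable (at t)" and "\<And>t. 0 < t \<Longrightarrow> deriv h t > 0"
    and "0 < s" "s \<le> t"
  shows "h s \<le> h t"
proof (cases "s = t")
  case False
  have "h s < h t"
  proof (rule DERIV_pos_imp_increasing[where f = h and a = s and b = t])
    show "s < t" using False assms by linarith
    fix z assume "s \<le> z" "z \<le> t"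
    then have z: "0 < z" using assms(3) by simp
    have "DERIV h z :> deriv h z"
      using assms(1)[OF z] by (simp only: DERIV_deriv_iff_real_differentiable)
    then show "\<exists>D. DERIV h z :> D \<and> 0 < D" using assms(2)[OF z] by blast
  qed
  then show ?thesis by simp
qed simp

lemma C1_on_quadrant_slices_mono:
  fixes f :: "real \<times> real \<Rightarrow> real"
  assumes f: "C1_on ({0..} \<times> {0..}) f"
  shows "(\<And>t. 0 < t \<Longrightarrow> deriv (\<lambda>t. f (a, t)) t > 0) \<Longrightarrow> 0 < a \<Longrightarrow> 0 < s \<Longrightarrow> s \<le> t \<Longrightarrow> f (a, s) \<le> f (a, t)"
    and "(\<And>t. 0 < t \<Longrightarrow> deriv (\<lambda>t. f (t, a)) t > 0) \<Longrightarrow> 0 < a \<Longrightarrow> 0 < s \<Longrightarrow> s \<le> t \<Longrightarrow> f (s, a) \<le> f (t, a)"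
proof -
  have d1: "(\<lambda>t. f (a, t)) differentiable (at t)" if "0 < a" "0 < t" for t
    by (rule differentiable_compose[of f "\<lambda>t. (a, t)"])
      (use C1_on_quadrant_differentiable[OF f that] in
        \<open>auto intro!: differentiableI has_derivative_Pair derivative_eq_intros simp: differentiable_def\<close>)
  have d2: "(\<lambda>t. f (t, a)) differentiable (at t)" if "0 < a" "0 < t" for t
    by (rule differentiable_compose[of f "\<lambda>t. (t, a)"])
      (use C1_on_quadrant_differentiable[OF f that(2,1)] in
        \<open>auto intro!: differentiableI has_derivative_Pair derivative_eq_intros simp: differentiable_def\<close>)
  show "(\<And>t. 0 < t \<Longrightarrow> deriv (\<lambda>t. f (a, t)) t > 0) \<Longrightarrow> 0 < a \<Longrightarrow> 0 < s \<Longrightarrow> s \<le> t \<Longrightarrow> f (a, s) \<le> f (a, t)"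
    by (rule deriv_pos_imp_mono[of "\<lambda>t. f (a, t)"]) (use d1 in auto)
  show "(\<And>t. 0 < t \<Longrightarrow> deriv (\<lambda>t. f (t, a)) t > 0) \<Longrightarrow> 0 < a \<Longrightarrow> 0 < s \<Longrightarrow> s \<le> t \<Longrightarrow> f (s, a) \<le> f (t, a)"
    by (rule deriv_pos_imp_mono[of "\<lambda>t. f (t, a)"]) (use d2 in auto)
qed

text \<open>
  The increment is split at \<open>(a, b')\<close>. Changing the first argument costs at most \<open>K \<bar>a' - a\<bar>\<close>. Changing
  the second one costs nothing if \<open>b\<close> increases, and otherwise at most \<open>K \<bar>b' - b\<bar> \<le> 2 K \<bar>a' - a\<bar>\<close>.
\<close>
lemma cooperative_increment_bound:
  fixes h :: "real \<Rightarrow> real \<Rightarrow> real"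
  assumes L1: "\<And>a a' b. a \<in> I \<Longrightarrow> a' \<in> I \<Longrightarrow> b \<in> I \<Longrightarrow> \<bar>h a b - h a' b\<bar> \<le> K * \<bar>a - a'\<bar>"
    and L2: "\<And>a b b'. a \<in> I \<Longrightarrow> b \<in> I \<Longrightarrow> b' \<in> I \<Longrightarrow> \<bar>h a b - h a b'\<bar> \<le> K * \<bar>b - b'\<bar>"
    and mono: "\<And>a b b'. a \<in> I \<Longrightarrow> b \<in> I \<Longrightarrow> b' \<in> I \<Longrightarrow> b \<le> b' \<Longrightarrow> h a b \<le> h a b'"
    and I: "a \<in> I" "a' \<in> I" "b \<in> I" "b' \<in> I"
    and K: "0 \<le> K" and neg: "a' - a < 0" and ge: "2 * (a' - a) \<le> b' - b"
  shows "3 * K * (a' - a) \<le> h a' b' - h a b"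
proof -
  have 1: "K * (a' - a) \<le> h a' b' - h a b'"
    using L1[of a' a b'] I neg by (simp add: abs_if algebra_simps split: if_splits)
  have 2: "2 * K * (a' - a) \<le> h a b' - h a b"
  proof (cases "b \<le> b'")
    case True
    have "2 * K * (a' - a) \<le> 0" using K neg by (intro mult_nonneg_nonpos) auto
    then show ?thesis using mono[of a b b'] I True by simp
  next
    case False
    have "K * (2 * (a' - a)) \<le> K * (b' - b)" using ge K by (rule mult_left_mono)
    then show ?thesis
      using L2[of a b' b] I False by (simp add: abs_if algebra_simps split: if_splits)
  qed
  show ?thesis using 1 2 by (simp add: algebra_simps)
qed

section \<open>Comparison in narrow slabs\<close>

lemma C11_loc_imp_continuous:
  assumes "u \<in> C11_loc"
  shows "continuous_on UNIV u"
  using assms unfolding C11_loc_def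
  by (auto simp: continuous_on_eq_continuous_at gderiv_def intro: has_derivative_continuous)

lemma continuous_decaying_imp_bounded:
  fixes u :: "'a::euclidean_space \<Rightarrow> real"
  assumes cont: "continuous_on UNIV u" and lim: "(u \<longlongrightarrow> 0) at_infinity"
  obtains M where "\<And>x. \<bar>u x\<bar> \<le> M"
proof -
  obtain R where R: "\<And>x. R \<le> norm x \<Longrightarrow> \<bar>u x\<bar> < 1"
    using tendstoD[OF lim, of 1] unfolding eventually_at_infinity by auto
  have "compact (u ` cball 0 R)"
    by (intro compact_continuous_image continuous_on_subset[OF cont]) auto
  then obtain M where M: "\<And>x. norm x \<le> R \<Longrightarrow> \<bar>u x\<bar> \<le> M"
    using compact_imp_bounded bounded_real by (metis image_eqI mem_cball_0)
  have "\<bar>u x\<bar> \<le> max M 1" for x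
    using R[of x] M[of x] by (cases "R \<le> norm x") (auto simp: le_max_iff_disj)
  then show ?thesis by (rule that)
qed

text \<open>
  One equation of the system suffices for one of the two claims; the nonlinearity is passed as a curried
  function so that the second claim follows by exchanging its arguments.
\<close>
lemma narrow_slab_min_comparison:
  fixes u v :: "real ^ 'n \<Rightarrow> real" and h :: "real \<Rightarrow> real \<Rightarrow> real"
  assumes \<alpha>: "0 < \<alpha>" and C: "0 < C" and e: "norm e = 1"
    and cont: "continuous_on UNIV u" and M: "\<And>y. \<bar>u y\<bar> \<le> M"
    and I: "\<And>y. u y \<in> I" "\<And>y. v y \<in> I"
    and lap: "\<And>y. has_frac_laplacian C \<alpha> u y (h (u y) (v y))"
    and L1: "\<And>a a' b. a \<in> I \<Longrightarrow> a' \<in> I \<Longrightarrow> b \<in> I \<Longrightarrow> \<bar>h a b - h a' b\<bar> \<le> K * \<bar>a - a'\<bar>"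
    and L2: "\<And>a b b'. a \<in> I \<Longrightarrow> b \<in> I \<Longrightarrow> b' \<in> I \<Longrightarrow> \<bar>h a b - h a b'\<bar> \<le> K * \<bar>b - b'\<bar>"
    and mono: "\<And>a b b'. a \<in> I \<Longrightarrow> b \<in> I \<Longrightarrow> b' \<in> I \<Longrightarrow> b \<le> b' \<Longrightarrow> h a b \<le> h a b'"
    and K: "0 \<le> K"
    and l: "3 * K * l powr \<alpha> < 2 * C * unit_ball_vol (real CARD('n)) / 5 powr (real CARD('n) + \<alpha>)"
    and x: "x \<in> slab e lam l"
    and min: "\<And>z. z \<in> closure (half_space e lam) \<Longrightarrow> refl_diff e lam u x \<le> refl_diff e lam u z"
    and neg: "refl_diff e lam u x < 0"
  shows "refl_diff e lam v x < 2 * refl_diff e lam u x"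
proof (rule ccontr)
  assume "\<not> ?thesis"
  then have ge: "2 * refl_diff e lam u x \<le> refl_diff e lam v x" by simp
  let ?R = "reflect e lam" and ?U = "refl_diff e lam u x"
  define A where "A = 2 * C * unit_ball_vol (real CARD('n)) / 5 powr (real CARD('n) + \<alpha>)"
  define d where "d = lam - x \<bullet> e"
  have d: "0 < d" "d < l" using x by (auto simp: slab_def half_space_def d_def)
  have A: "0 < A" using C by (simp add: A_def)
  have "e \<noteq> 0" using e by auto
  then have "y \<in> closure (half_space e lam)" if "y \<bullet> e \<le> lam" for y
    using that closure_halfspace_lt[of e lam] by (simp add: half_space_def inner_commute)
  then have "h (u (?R x)) (v (?R x)) - h (u x) (v x) \<le> A * ?U / d powr \<alpha>"
    using frac_laplacian_antisymmetric_min[OF \<alpha> C e cont M lap lap _ _ neg] min d(1)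
    by (simp add: A_def d_def)
  moreover have "3 * K * ?U \<le> h (u (?R x)) (v (?R x)) - h (u x) (v x)"
    using cooperative_increment_bound[where h = h and I = I, OF L1 L2 mono, of "u x" "u (?R x)" "v x" "v (?R x)"]
      I K neg ge by (simp add: refl_diff_def)
  ultimately have "3 * K * ?U \<le> A / d powr \<alpha> * ?U" by simp
  then have "A / d powr \<alpha> \<le> 3 * K"
    using neg by (simp only: mult_le_cancel_right)
  then have "A \<le> 3 * K * d powr \<alpha>" using d by (simp add: field_simps)
  also have "\<dots> \<le> 3 * K * l powr \<alpha>"
    using d K \<alpha> by (intro mult_left_mono powr_mono2) auto
  finally show False using l by (simp add: A_def)
qed

lemma exists_small_powr:
  fixes \<alpha> A B :: real
  assumes "0 < \<alpha>" "0 < A" "0 \<le> B"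
  obtains l0 where "0 < l0" "\<And>l. 0 < l \<Longrightarrow> l \<le> l0 \<Longrightarrow> B * l powr \<alpha> < A"
proof
  define l0 where "l0 = (A / (B + 1)) powr (1 / \<alpha>)"
  show "0 < l0" using assms by (simp add: l0_def)
  fix l assume l: "0 < l" "l \<le> l0"
  have "l powr \<alpha> \<le> l0 powr \<alpha>" using l assms by (intro powr_mono2) auto
  also have "l0 powr \<alpha> = A / (B + 1)" using assms by (simp add: l0_def powr_powr)
  finally have "(B + 1) * l powr \<alpha> \<le> A" using assms by (simp add: field_simps)
  moreover have "0 < l powr \<alpha>" using l by simp
  ultimately show "B * l powr \<alpha> < A" unfolding distrib_right by linarith
qed

theorem proposition10:
  fixes \<alpha> C :: real
    and f g :: "real \<times> real \<Rightarrow> real"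
    and u v :: "real ^ 'n \<Rightarrow> real"
    and e :: "real ^ 'n"
  assumes "0 < \<alpha>" and "\<alpha> < 2" and "0 < C"
    and "norm e = 1"
    and "C1_on ({0..} \<times> {0..}) f" and "C1_on ({0..} \<times> {0..}) g"
    and "u \<in> L_alpha \<alpha> \<inter> C11_loc" and "v \<in> L_alpha \<alpha> \<inter> C11_loc"
    and "\<And>x. has_frac_laplacian C \<alpha> u x (f (u x, v x))"
    and "\<And>x. has_frac_laplacian C \<alpha> v x (g (u x, v x))"
    and "\<And>x. u x > 0" and "\<And>x. v x > 0"
    and "(u \<longlongrightarrow> 0) at_infinity" and "(v \<longlongrightarrow> 0) at_infinity"
    and "\<And>a b. 0 < a \<Longrightarrow> 0 < b \<Longrightarrow> deriv (\<lambda>t. f (a, t)) b > 0"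
    and "\<And>a b. 0 < a \<Longrightarrow> 0 < b \<Longrightarrow> deriv (\<lambda>s. g (s, b)) a > 0"
  shows "\<exists>l0>0. \<forall>l. 0 < l \<and> l \<le> l0 \<longrightarrow> (\<forall>lam.
      (\<forall>x\<in>slab e lam l.
         (\<forall>z\<in>closure (half_space e lam). refl_diff e lam u x \<le> refl_diff e lam u z) \<and>
         refl_diff e lam u x < 0 \<longrightarrow>
         refl_diff e lam v x < 2 * refl_diff e lam u x \<and> 2 * refl_diff e lam u x < 0) \<and>
      (\<forall>y\<in>slab e lam l.
         (\<forall>z\<in>closure (half_space e lam). refl_diff e lam v y \<le> refl_diff e lam v z) \<and>
         refl_diff e lam v y < 0 \<longrightarrow>
         refl_diff e lam u y < 2 * refl_diff e lam v y \<and> 2 * refl_diff e lam v y < 0))"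
proof -
  have cu: "continuous_on UNIV u" and cv: "continuous_on UNIV v"
    using assms(7,8) by (auto intro: C11_loc_imp_continuous)
  obtain Mu Mv where Mu: "\<And>x. \<bar>u x\<bar> \<le> Mu" and Mv: "\<And>x. \<bar>v x\<bar> \<le> Mv"
    using continuous_decaying_imp_bounded[OF cu assms(13)]
      continuous_decaying_imp_bounded[OF cv assms(14)] by metis
  define M where "M = max Mu Mv"
  define I where "I = {0<..M}"
  have I: "u x \<in> I" "v x \<in> I" for x
    using Mu[of x] Mv[of x] assms(11)[of x] assms(12)[of x] by (auto simp: I_def M_def le_max_iff_disj)
  obtain Kf where Kf: "0 < Kf" "\<And>p q. p \<in> {0..M} \<times> {0..M} \<Longrightarrow> q \<in> {0..M} \<times> {0..M} \<Longrightarrow>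
      \<bar>f p - f q\<bar> \<le> Kf * norm (p - q)"
    using C1_on_quadrant_Lipschitz_box[OF assms(5)] by metis
  obtain Kg where Kg: "0 < Kg" "\<And>p q. p \<in> {0..M} \<times> {0..M} \<Longrightarrow> q \<in> {0..M} \<times> {0..M} \<Longrightarrow>
      \<bar>g p - g q\<bar> \<le> Kg * norm (p - q)"
    using C1_on_quadrant_Lipschitz_box[OF assms(6)] by metis
  have f1: "\<bar>f (a, b) - f (a', b)\<bar> \<le> Kf * \<bar>a - a'\<bar>"
    and f2: "\<bar>f (b, a) - f (b, a')\<bar> \<le> Kf * \<bar>a - a'\<bar>"
    and g1: "\<bar>g (a, b) - g (a', b)\<bar> \<le> Kg * \<bar>a - a'\<bar>"
    and g2: "\<bar>g (b, a) - g (b, a')\<bar> \<le> Kg * \<bar>a - a'\<bar>"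
    if "a \<in> I" "a' \<in> I" "b \<in> I" for a a' b
    using that Kf(2)[of "(a, b)" "(a', b)"] Kf(2)[of "(b, a)" "(b, a')"]
      Kg(2)[of "(a, b)" "(a', b)"] Kg(2)[of "(b, a)" "(b, a')"]
    by (auto simp: I_def norm_Pair)
  have fm: "f (a, b) \<le> f (a, b')" if "a \<in> I" "b \<in> I" "b' \<in> I" "b \<le> b'" for a b b'
    using C1_on_quadrant_slices_mono(1)[OF assms(5), of a b b'] assms(15) that by (auto simp: I_def)
  have gm: "g (b, a) \<le> g (b', a)" if "a \<in> I" "b \<in> I" "b' \<in> I" "b \<le> b'" for a b b'
    using C1_on_quadrant_slices_mono(2)[OF assms(6), of a b b'] assms(16) that by (auto simp: I_def)
  define A where "A = 2 * C * unit_ball_vol (real CARD('n)) / 5 powr (real CARD('n) + \<alpha>)"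
  have A: "0 < A" using assms(3) by (simp add: A_def)
  obtain l1 where l1: "0 < l1" "\<And>l. 0 < l \<Longrightarrow> l \<le> l1 \<Longrightarrow> 3 * Kf * l powr \<alpha> < A"
    using exists_small_powr[OF assms(1) A, of "3 * Kf"] Kf(1) by auto
  obtain l2 where l2: "0 < l2" "\<And>l. 0 < l \<Longrightarrow> l \<le> l2 \<Longrightarrow> 3 * Kg * l powr \<alpha> < A"
    using exists_small_powr[OF assms(1) A, of "3 * Kg"] Kg(1) by auto
  show ?thesis
  proof (intro exI[of _ "min l1 l2"] conjI allI impI ballI)
    show "0 < min l1 l2" using l1(1) l2(1) by simp
    fix l lam x
    assume l: "0 < l \<and> l \<le> min l1 l2" and x: "x \<in> slab e lam l"
    note base = narrow_slab_min_comparison[OF assms(1,3,4)]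
    show "refl_diff e lam v x < 2 * refl_diff e lam u x"
      if H: "(\<forall>z\<in>closure (half_space e lam). refl_diff e lam u x \<le> refl_diff e lam u z) \<and> refl_diff e lam u x < 0"
      by (rule base[OF cu Mu I(1) I(2), where h = "\<lambda>a b. f (a, b)" and K = Kf and l = l and lam = lam])
        (use assms(9) f1 f2 fm Kf(1) l1 l x H in \<open>auto simp: A_def\<close>)
    show "refl_diff e lam u x < 2 * refl_diff e lam v x"
      if H: "(\<forall>z\<in>closure (half_space e lam). refl_diff e lam v x \<le> refl_diff e lam v z) \<and> refl_diff e lam v x < 0"
      by (rule base[OF cv Mv I(2) I(1), where h = "\<lambda>b a. g (a, b)" and K = Kg and l = l and lam = lam])
        (use assms(10) g1 g2 gm Kg(1) l2 l x H in \<open>auto simp: A_def\<close>)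
  qed auto
qed

end
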